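(* Let $U\in U(N)$ have all entries nonzero. The following are equivalent. (a) For every differentiable function $\varphi:(0,\infty)\to\mathbb R$, the matrix $U$ is a critical point on the manifold $U(N)$ of $F(V)=\sum_{i,j}\varphi(|V_{ij}|)$. (b) $U$ is semi-balanced.
   Context: The color decomposition of $U\in M_N(\mathbb C)$ is $U=\sum_{r>0}rU_r$. Here $U_r$ is the matrix with $(U_r)_{ij}=U_{ij}/|U_{ij}|$ if $|U_{ij}|=r$, and $(U_r)_{ij}=0$ otherwise. Only finitely many $U_r$ are nonzero. A unitary matrix $U$ is semi-balanced if, for every $r>0$, the matrices $U_rU^*$ and $U^*U_r$ are self-adjoint. *)

theory Defs
  imports "HOL-Analysis.Analysis"
begin

definition cadjoint :: "complex ^ 'n ^ 'm \<Rightarrow> complex ^ 'm ^ 'n" where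
  "cadjoint A = (\<chi> i j. cnj (A $ j $ i))"

definition self_adjoint :: "complex ^ 'n ^ 'n \<Rightarrow> bool" where
  "self_adjoint A \<longleftrightarrow> cadjoint A = A"

definition unitary_group :: "(complex ^ 'n ^ 'n) set" where
  "unitary_group = {U. cadjoint U ** U = mat 1 \<and> U ** cadjoint U = mat 1}"

definition color_component :: "real \<Rightarrow> complex ^ 'n ^ 'n \<Rightarrow> complex ^ 'n ^ 'n" where
  "color_component r U =
     (\<chi> i j. if cmod (U $ i $ j) = r then U $ i $ j / complex_of_real (cmod (U $ i $ j)) else 0)"

definition semi_balanced :: "complex ^ 'n ^ 'n \<Rightarrow> bool" where
  "semi_balanced U \<longleftrightarrow> U \<in> unitary_group \<and>
     (\<forall>r>0. self_adjoint (color_component r U ** cadjoint U) \<and>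
            self_adjoint (cadjoint U ** color_component r U))"

text \<open>The tangent space of an embedded submanifold \<open>S\<close> at \<open>p\<close>, realised in the ambient space
  as the set of velocities of differentiable curves in \<open>S\<close> through \<open>p\<close>.\<close>

definition tangent_space :: "'a::real_normed_vector set \<Rightarrow> 'a \<Rightarrow> 'a set" where
  "tangent_space S p =
     {v. \<exists>\<gamma> \<epsilon>. (0::real) < \<epsilon> \<and> \<gamma> differentiable_on {-\<epsilon><..<\<epsilon>} \<and>
           (\<forall>t\<in>{-\<epsilon><..<\<epsilon>}. \<gamma> t \<in> S) \<and> \<gamma> 0 = p \<and>
           (\<gamma> has_vector_derivative v) (at 0)}"

text \<open>\<open>F\<close> is differentiable at \<open>p\<close> along \<open>S\<close> and its differential vanishes on the tangent space.
  A derivative within \<open>S\<close> is in general determined only on tangent vectors, which is all that is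
  used. The condition depends only on the values of \<open>F\<close> on \<open>S\<close> near \<open>p\<close>.\<close>

definition critical_point_on :: "'a::real_normed_vector set \<Rightarrow> ('a \<Rightarrow> real) \<Rightarrow> 'a \<Rightarrow> bool" where
  "critical_point_on S F p \<longleftrightarrow> p \<in> S \<and>
     (\<exists>F'. (F has_derivative F') (at p within S) \<and> (\<forall>v\<in>tangent_space S p. F' v = 0))"

end

theory Submission
  imports Defs
begin

text \<open>With respect to the real inner product \<open>Re tr (A\<^sup>*B)\<close>, the gradient of \<open>F\<close> at \<open>U\<close> is
  \<open>G = \<Sum>r. \<phi>'(r) U\<^sub>r\<close>. The tangent vectors at \<open>U\<close> are the \<open>AU\<close> with \<open>A\<close> skew-adjoint, and
  \<open>\<langle>G, AU\<rangle> = \<langle>GU\<^sup>*, A\<rangle>\<close>, so \<open>U\<close> is critical iff \<open>GU\<^sup>*\<close> is orthogonal to all skew-adjoint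
  matrices, i.e. self-adjoint. It suffices to test \<open>A = \<i>vv\<^sup>*\<close>, whose one-parameter group is
  explicit. As the \<open>\<phi>'(r)\<close> are arbitrary on the finitely many moduli of entries, this holds for
  all \<open>\<phi>\<close> iff every \<open>U\<^sub>rU\<^sup>*\<close> is self-adjoint; conjugation by \<open>U\<close> yields \<open>U\<^sup>*U\<^sub>r\<close>.\<close>

section \<open>Adjoints and the real inner product on matrices\<close>

text \<open>\<open>*\<^sub>R\<close> acts on matrices by real scalars only, whereas skew-adjoint
  test matrices arise as \<i> times self-adjoint ones.\<close>

definition complex_scale :: "complex \<Rightarrow> complex ^ 'n ^ 'm \<Rightarrow> complex ^ 'n ^ 'm" where
  "complex_scale c A = (\<chi> i j. c * A $ i $ j)"

lemma complex_scale_matrix_mult: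
  "complex_scale c A ** B = complex_scale c (A ** B)"
  by (simp add: complex_scale_def matrix_matrix_mult_def vec_eq_iff sum_distrib_left mult.assoc)

lemma matrix_mult_complex_scale:
  "A ** complex_scale c B = complex_scale c (A ** B)"
  by (simp add: complex_scale_def matrix_matrix_mult_def vec_eq_iff sum_distrib_left
      mult.left_commute)

lemma bounded_linear_complex_scale_left:
  "bounded_linear (\<lambda>c. complex_scale c (A :: complex ^ 'n ^ 'm))"
proof -
  have "linear (\<lambda>c. complex_scale c A)"
    by (rule linearI) (simp_all add: complex_scale_def vec_eq_iff algebra_simps)
  then show ?thesis
    by (simp add: linear_conv_bounded_linear)
qed

lemma cadjoint_component [simp]: "cadjoint A $ i $ j = cnj (A $ j $ i)"
  by (simp add: cadjoint_def)

lemma cadjoint_cadjoint [simp]: "cadjoint (cadjoint A) = A"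
  by (simp add: vec_eq_iff)

lemma cadjoint_add: "cadjoint (A + B) = cadjoint A + cadjoint B"
  by (simp add: vec_eq_iff)

lemma cadjoint_scaleR: "cadjoint (a *\<^sub>R A) = a *\<^sub>R cadjoint A"
  by (simp add: vec_eq_iff)

lemma cadjoint_mat_1 [simp]: "cadjoint (mat 1) = mat 1"
  by (auto simp: vec_eq_iff mat_def)

lemma cadjoint_complex_scale: "cadjoint (complex_scale c A) = complex_scale (cnj c) (cadjoint A)"
  by (simp add: vec_eq_iff complex_scale_def)

lemma cadjoint_matrix_mult: "cadjoint (A ** B) = cadjoint B ** cadjoint A"
  by (simp add: matrix_matrix_mult_def vec_eq_iff mult.commute)

lemma bounded_linear_cadjoint:
  "bounded_linear (cadjoint :: complex ^ 'n ^ 'm \<Rightarrow> complex ^ 'm ^ 'n)"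
proof -
  have "linear (cadjoint :: complex ^ 'n ^ 'm \<Rightarrow> complex ^ 'm ^ 'n)"
    by (rule linearI) (simp_all add: cadjoint_add cadjoint_scaleR)
  then show ?thesis
    by (simp add: linear_conv_bounded_linear)
qed

lemma bounded_bilinear_complex_matrix_mult:
  "bounded_bilinear ((**) :: complex ^ 'n ^ 'm \<Rightarrow> complex ^ 'p ^ 'n \<Rightarrow> complex ^ 'p ^ 'm)"
proof -
  have "bilinear ((**) :: complex ^ 'n ^ 'm \<Rightarrow> complex ^ 'p ^ 'n \<Rightarrow> complex ^ 'p ^ 'm)"
    unfolding bilinear_def
    by (intro conjI allI linearI)
      (simp_all add: matrix_matrix_mult_def vec_eq_iff algebra_simps sum.distrib scaleR_sum_right)
  then show ?thesis
    by (simp add: bilinear_conv_bounded_bilinear)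
qed

lemma inner_complex_matrix:
  fixes A B :: "complex ^ 'n ^ 'm"
  shows "A \<bullet> B = (\<Sum>i\<in>UNIV. \<Sum>j\<in>UNIV. Re (cnj (A $ i $ j) * B $ i $ j))"
  by (simp add: inner_vec_def inner_complex_def)

lemma inner_cadjoint: "cadjoint A \<bullet> cadjoint B = A \<bullet> B"
  unfolding inner_complex_matrix by (subst sum.swap) simp

text \<open>Cyclicity of the trace, carried out by swapping the two inner sums. It moves
  \<open>U\<close> off a tangent vector \<open>A ** U\<close> and onto the gradient.\<close>

lemma inner_matrix_mult_right:
  fixes G :: "complex ^ 'n ^ 'm"
  shows "G \<bullet> (A ** U) = (G ** cadjoint U) \<bullet> A"
proof -
  have "G \<bullet> (A ** U)
      = (\<Sum>i\<in>UNIV. \<Sum>j\<in>UNIV. \<Sum>k\<in>UNIV. Re (cnj (G $ i $ j) * (A $ i $ k * U $ k $ j)))"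
    by (simp only: inner_complex_matrix matrix_matrix_mult_def vec_lambda_beta sum_distrib_left
        Re_sum)
  also have "\<dots> = (\<Sum>i\<in>UNIV. \<Sum>k\<in>UNIV. \<Sum>j\<in>UNIV. Re (cnj (G $ i $ j) * (A $ i $ k * U $ k $ j)))"
    by (intro sum.cong refl sum.swap)
  also have "\<dots> = (G ** cadjoint U) \<bullet> A"
    by (simp only: inner_complex_matrix matrix_matrix_mult_def vec_lambda_beta sum_distrib_right
        Re_sum cnj_sum complex_cnj_mult cadjoint_component complex_cnj_cnj)
      (simp only: mult_ac)
  finally show ?thesis .
qed

text \<open>Taking adjoints preserves the inner product but here reverses its sign.\<close>

lemma self_adjoint_inner_skew:
  assumes "self_adjoint X" "cadjoint A = - A"
  shows "X \<bullet> A = 0"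
  using inner_cadjoint[of X A] assms by (simp add: self_adjoint_def)

lemma self_adjoint_sum_scaleR:
  assumes "\<And>r. r \<in> R \<Longrightarrow> self_adjoint (X r)"
  shows "self_adjoint (\<Sum>r\<in>R. d r *\<^sub>R X r)"
  unfolding self_adjoint_def linear_sum[OF bounded_linear.linear[OF bounded_linear_cadjoint]]
  by (rule sum.cong) (use assms in \<open>auto simp: cadjoint_scaleR self_adjoint_def\<close>)

section \<open>Rank-one tests for self-adjointness\<close>

definition outer_product :: "complex ^ 'm \<Rightarrow> complex ^ 'n \<Rightarrow> complex ^ 'n ^ 'm" where
  "outer_product v w = (\<chi> i j. v $ i * cnj (w $ j))"

lemma self_adjoint_outer_product: "self_adjoint (outer_product v v)"
  by (simp add: self_adjoint_def vec_eq_iff outer_product_def)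

text \<open>In \<open>v v\<^sup>* v v\<^sup>*\<close> the middle factor \<open>v\<^sup>* v\<close>
  is a scalar; it is real and equals \<open>v \<bullet> v\<close>.\<close>

lemma outer_product_idem:
  "outer_product v v ** outer_product v v = (v \<bullet> v) *\<^sub>R outer_product v v"
proof -
  have eq: "complex_of_real (v \<bullet> v) = (\<Sum>k\<in>UNIV. cnj (v $ k) * v $ k)"
    by (simp only: inner_vec_def of_real_sum inner_complex_def)
      (simp add: complex_eq_iff algebra_simps)
  have "(\<Sum>k\<in>UNIV. v $ i * cnj (v $ k) * (v $ k * cnj (v $ j)))
      = (v \<bullet> v) *\<^sub>R (v $ i * cnj (v $ j))" for i j
    unfolding scaleR_conv_of_real eq sum_distrib_right by (simp add: mult_ac)
  then show ?thesis
    by (simp add: vec_eq_iff outer_product_def matrix_matrix_mult_def)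
qed

text \<open>By polarization the matrices \<open>v v\<^sup>*\<close> span all self-adjoint ones over
  the reals. Only nonzero \<open>v\<close> are tested, so that \<open>v \<bullet> v\<close> can
  later serve as the divisor \<open>s\<close>.\<close>

lemma self_adjointI_outer_product:
  fixes X :: "complex ^ 'n ^ 'n"
  assumes X: "\<And>v. v \<noteq> 0 \<Longrightarrow> X \<bullet> complex_scale \<i> (outer_product v v) = 0"
  shows "self_adjoint X"
proof -
  have X0: "X \<bullet> complex_scale \<i> (outer_product v v) = 0" for v
  proof (cases "v = 0")
    case True
    then have "complex_scale \<i> (outer_product v v) = 0"
      by (simp add: complex_scale_def outer_product_def vec_eq_iff)
    then show ?thesis by simp
  qed (use X in auto)
  have polar: "X \<bullet> complex_scale \<i> (outer_product v w)
      + X \<bullet> complex_scale \<i> (outer_product w v) = 0" for v w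
  proof -
    have "complex_scale \<i> (outer_product (v + w) (v + w))
        = complex_scale \<i> (outer_product v v) + complex_scale \<i> (outer_product w w)
          + (complex_scale \<i> (outer_product v w) + complex_scale \<i> (outer_product w v))"
      by (simp add: complex_scale_def outer_product_def vec_eq_iff algebra_simps)
    with X0[of "v + w"] X0[of v] X0[of w] show ?thesis
      by (simp add: inner_add_right)
  qed
  have entry: "X \<bullet> complex_scale \<i> (outer_product (axis k a) (axis l b))
      = Re (cnj (X $ k $ l) * (\<i> * (a * cnj b)))" for k l a b
  proof -
    have "complex_scale \<i> (outer_product (axis k a) (axis l b))
        = axis k (axis l (\<i> * (a * cnj b)))"
      by (auto simp: complex_scale_def outer_product_def vec_eq_iff axis_def)
    then show ?thesis
      by (simp add: inner_axis inner_complex_def)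
  qed
  have "cnj (X $ l $ k) = X $ k $ l" for k l
  proof -
    \<comment> \<open>Basis vectors \<open>e\<^sub>k\<close>, \<open>e\<^sub>l\<close> detect
      imaginary parts; replacing \<open>e\<^sub>l\<close> by \<open>\<i> e\<^sub>l\<close> detects
      real parts.\<close>
    have "Im (X $ k $ l) + Im (X $ l $ k) = 0"
      using polar[of "axis k 1" "axis l 1"] by (simp add: entry)
    moreover have "Re (X $ k $ l) = Re (X $ l $ k)"
      using polar[of "axis k 1" "axis l \<i>"] by (simp add: entry)
    ultimately show ?thesis
      by (simp add: complex_eq_iff)
  qed
  then show ?thesis
    by (simp add: self_adjoint_def vec_eq_iff)
qed

section \<open>Tangent vectors of the unitary group\<close>

text \<open>Differentiate \<open>\<gamma> \<gamma>\<^sup>* = 1\<close> at 0 by the product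
  rule.\<close>

lemma tangent_space_unitary_group_skew:
  assumes "v \<in> tangent_space unitary_group U"
  shows "cadjoint (v ** cadjoint U) = - (v ** cadjoint U)"
proof -
  obtain \<gamma> \<epsilon> where \<epsilon>: "0 < \<epsilon>" and \<gamma>: "\<And>t. t \<in> {-\<epsilon><..<\<epsilon>} \<Longrightarrow> \<gamma> t \<in> unitary_group"
    and \<gamma>0: "\<gamma> 0 = U" and deriv: "(\<gamma> has_vector_derivative v) (at 0)"
    using assms unfolding tangent_space_def by blast
  have "((\<lambda>t. \<gamma> t ** cadjoint (\<gamma> t)) has_vector_derivative
      \<gamma> 0 ** cadjoint v + v ** cadjoint (\<gamma> 0)) (at 0)"
    by (rule bounded_bilinear.has_vector_derivative[OF bounded_bilinear_complex_matrix_mult deriv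
          bounded_linear.has_vector_derivative[OF bounded_linear_cadjoint deriv]])
  moreover have "((\<lambda>t. \<gamma> t ** cadjoint (\<gamma> t)) has_vector_derivative 0) (at 0)"
    by (rule has_vector_derivative_transform_within_open[where S = "{-\<epsilon><..<\<epsilon>}"
          and f = "\<lambda>_. mat 1"])
      (use \<epsilon> \<gamma> in \<open>auto simp: unitary_group_def\<close>)
  ultimately have "U ** cadjoint v + v ** cadjoint U = 0"
    using vector_derivative_unique_at \<gamma>0 by blast
  then show ?thesis
    by (simp add: cadjoint_matrix_mult eq_neg_iff_add_eq_0)
qed

text \<open>Since \<open>P\<^sup>2 = s P\<close>, the one-parameter group \<open>exp (\<i>tP)\<close> has the closed form
  \<open>1 + s\<^sup>-\<^sup>1 (exp (\<i>st) - 1) P\<close>.\<close>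

lemma tangent_space_unitary_groupI:
  fixes U P :: "complex ^ 'n ^ 'n"
  assumes U: "U \<in> unitary_group" and P: "self_adjoint P" "P ** P = s *\<^sub>R P" and s: "s \<noteq> 0"
  shows "complex_scale \<i> P ** U \<in> tangent_space unitary_group U"
proof -
  define c where "c t = (cis (s * t) - 1) / of_real s" for t
  define W where "W t = mat 1 + complex_scale (c t) P" for t
  have cadj: "cadjoint (W t) = mat 1 + complex_scale (cnj (c t)) P" for t
    using P(1) by (simp add: W_def cadjoint_add cadjoint_complex_scale self_adjoint_def)
  \<comment> \<open>This is \<open>|1 + s c|\<^sup>2 = 1\<close> expanded and divided by
    \<open>s\<close>, where \<open>1 + s c = cis (s t)\<close>. It is the scalar form of unitarity
    of \<open>W t\<close>.\<close>
  have c: "c t + cnj (c t) + of_real s * (c t * cnj (c t)) = 0" for t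
  proof -
    have "cis (s * t) * cnj (cis (s * t)) = 1"
      by (simp add: cis_cnj cis_mult)
    then show ?thesis
      using s by (simp add: c_def field_simps)
  qed
  have mult: "(mat 1 + complex_scale a P) ** (mat 1 + complex_scale b P)
      = mat 1 + complex_scale (a + b + of_real s * (a * b)) P" for a b
  proof -
    have "complex_scale a P ** complex_scale b P = complex_scale (of_real s * (a * b)) P"
      by (simp add: complex_scale_matrix_mult matrix_mult_complex_scale P(2))
        (simp add: complex_scale_def vec_eq_iff, simp add: scaleR_conv_of_real mult_ac)
    then show ?thesis
      by (simp add: matrix_add_ldistrib
          bounded_bilinear.add_left[OF bounded_bilinear_complex_matrix_mult])
        (simp add: complex_scale_def vec_eq_iff algebra_simps)
  qed
  have W: "cadjoint (W t) ** W t = mat 1" "W t ** cadjoint (W t) = mat 1" for t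
    using c[of t] unfolding cadj unfolding W_def mult
    by (simp_all add: add.commute mult.commute) (simp_all add: complex_scale_def vec_eq_iff)
  have in_group: "W t ** U \<in> unitary_group" for t
  proof -
    have "cadjoint (W t ** U) ** (W t ** U) = cadjoint U ** (cadjoint (W t) ** W t) ** U"
      and "(W t ** U) ** cadjoint (W t ** U) = W t ** (U ** cadjoint U) ** cadjoint (W t)"
      by (simp_all add: cadjoint_matrix_mult matrix_mul_assoc)
    then show ?thesis
      using U by (simp add: W unitary_group_def)
  qed
  have deriv: "((\<lambda>t. W t ** U) has_vector_derivative
      complex_scale (\<i> * cis (s * t)) P ** U) (at t)" for t
  proof -
    have "(c has_vector_derivative \<i> * cis (s * t)) (at t)"
      unfolding c_def cis_conv_exp
      by (rule has_vector_derivative_real_field derivative_eq_intros refl | use s in simp)+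
    then have "(W has_vector_derivative 0 + complex_scale (\<i> * cis (s * t)) P) (at t)"
      unfolding W_def
      by (intro has_vector_derivative_add has_vector_derivative_const
          bounded_linear.has_vector_derivative[OF bounded_linear_complex_scale_left])
    then show ?thesis
      using bounded_linear.has_vector_derivative[OF
          bounded_bilinear.bounded_linear_left[OF bounded_bilinear_complex_matrix_mult]]
      by fastforce
  qed
  have "(\<lambda>t. W t ** U) differentiable_on {-1<..<1}"
    using deriv
    by (auto simp: differentiable_on_def has_vector_derivative_def
        intro: differentiable_at_withinI differentiableI)
  moreover have "W 0 = mat 1"
    by (simp add: W_def c_def complex_scale_def vec_eq_iff)
  ultimately show ?thesis
    unfolding tangent_space_def
    using in_group deriv[of 0] by (intro CollectI exI[of _ "\<lambda>t. W t ** U"] exI[of _ 1]) simp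
qed

text \<open>Along a curve in \<open>S\<close>, both derivatives become that of one function of a
  real variable, which is unique. Hence criticality may be tested with any derivative within
  \<open>S\<close>.\<close>

lemma has_derivative_tangent_space_unique:
  fixes F :: "'a::real_normed_vector \<Rightarrow> 'b::real_normed_vector"
  assumes "(F has_derivative F1) (at p within S)" "(F has_derivative F2) (at p within S)"
    and "v \<in> tangent_space S p"
  shows "F1 v = F2 v"
proof -
  obtain \<gamma> \<epsilon> where \<epsilon>: "0 < \<epsilon>" and \<gamma>: "\<gamma> ` {-\<epsilon><..<\<epsilon>} \<subseteq> S"
    and \<gamma>0: "\<gamma> 0 = p" and deriv: "(\<gamma> has_derivative (\<lambda>t. t *\<^sub>R v)) (at 0)"
    using assms(3) unfolding tangent_space_def has_vector_derivative_def by auto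
  \<comment> \<open>The chain rule along the curve only sees the interval; as 0 is interior, this is
    the full derivative.\<close>
  have at: "at (0::real) within {-\<epsilon><..<\<epsilon>} = at 0"
    using \<epsilon> by (intro at_within_open) auto
  have "((\<lambda>t. F (\<gamma> t)) has_derivative (\<lambda>t. F' (t *\<^sub>R v))) (at 0)"
    if "(F has_derivative F') (at p within S)" for F'
    using has_derivative_in_compose[of \<gamma> _ 0 "{-\<epsilon><..<\<epsilon>}" F F']
      has_derivative_subset[OF that \<gamma>] deriv at \<gamma>0 by simp
  from has_derivative_unique[OF this[OF assms(1)] this[OF assms(2)]]
  have "F1 (1 *\<^sub>R v) = F2 (1 *\<^sub>R v)" by metis
  then show ?thesis by simp
qed

section \<open>The differential and the color decomposition\<close>

text \<open>For \<open>d\<close> the derivative of \<phi> this is the gradient of \<open>F\<close>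
  at \<open>U\<close>, as \<open>sgn z\<close> is the gradient of the modulus at nonzero
  \<open>z\<close>.\<close>

definition color_weighted :: "(real \<Rightarrow> real) \<Rightarrow> complex ^ 'n ^ 'n \<Rightarrow> complex ^ 'n ^ 'n" where
  "color_weighted d U = (\<chi> i j. d (cmod (U $ i $ j)) *\<^sub>R sgn (U $ i $ j))"

text \<open>At each entry only the color equal to its modulus contributes.\<close>

lemma color_weighted_eq_sum:
  "color_weighted d U
    = (\<Sum>r\<in>range (\<lambda>(i, j). cmod (U $ i $ j)). d r *\<^sub>R color_component r U)"
proof -
  have fin: "finite (range (\<lambda>(i, j). cmod (U $ i $ j)))" by simp
  have "color_weighted d U $ i $ j
      = (\<Sum>r\<in>range (\<lambda>(i, j). cmod (U $ i $ j)). (d r *\<^sub>R color_component r U) $ i $ j)" for i j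
  proof -
    have "cmod (U $ i $ j) \<in> range (\<lambda>(i, j). cmod (U $ i $ j))"
      by (force intro: rev_image_eqI[of "(i, j)"])
    moreover have "(\<Sum>r\<in>range (\<lambda>(i, j). cmod (U $ i $ j)). (d r *\<^sub>R color_component r U) $ i $ j)
        = (\<Sum>r\<in>range (\<lambda>(i, j). cmod (U $ i $ j)).
            if cmod (U $ i $ j) = r then d r *\<^sub>R sgn (U $ i $ j) else 0)"
      by (intro sum.cong refl) (simp add: color_component_def sgn_eq)
    ultimately show ?thesis
      using fin by (simp add: color_weighted_def)
  qed
  then show ?thesis
    by (simp add: vec_eq_iff sum_component)
qed

text \<open>Chain rule entry by entry; nonzero entries keep away from the point where the modulus is
  not differentiable.\<close>

lemma has_derivative_sum_cmod:
  fixes U :: "complex ^ 'n ^ 'n"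
  assumes nz: "\<And>i j. U $ i $ j \<noteq> 0"
    and d: "\<And>i j. (\<phi> has_real_derivative d (cmod (U $ i $ j))) (at (cmod (U $ i $ j)))"
  shows "((\<lambda>V. \<Sum>i\<in>UNIV. \<Sum>j\<in>UNIV. \<phi> (cmod (V $ i $ j))) has_derivative
      (\<lambda>H. color_weighted d U \<bullet> H)) (at U)"
proof -
  have entry: "((\<lambda>V :: complex ^ 'n ^ 'n. \<phi> (cmod (V $ i $ j))) has_derivative
      (\<lambda>H. (d (cmod (U $ i $ j)) *\<^sub>R sgn (U $ i $ j)) \<bullet> H $ i $ j)) (at U)" for i j
  proof -
    have "bounded_linear (\<lambda>V :: complex ^ 'n ^ 'n. V $ i $ j)"
      by (intro bounded_linear_compose[OF bounded_linear_vec_nth bounded_linear_vec_nth])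
    then have "((\<lambda>V :: complex ^ 'n ^ 'n. V $ i $ j) has_derivative (\<lambda>H. H $ i $ j)) (at U)"
      by (rule bounded_linear_imp_has_derivative)
    from has_derivative_compose[OF this has_derivative_norm[OF nz]]
    have "((\<lambda>V :: complex ^ 'n ^ 'n. cmod (V $ i $ j)) has_derivative
        (\<lambda>H. sgn (U $ i $ j) \<bullet> H $ i $ j)) (at U)" by (simp add: inner_commute)
    from has_derivative_compose[OF this d[unfolded has_field_derivative_def]]
    show ?thesis by simp
  qed
  show ?thesis
    unfolding color_weighted_def inner_vec_def vec_lambda_beta
    by (intro has_derivative_sum entry)
qed

lemma critical_point_on_unitary_group_iff:
  fixes U :: "complex ^ 'n ^ 'n"
  assumes U: "U \<in> unitary_group" and nz: "\<And>i j. U $ i $ j \<noteq> 0"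
    and d: "\<And>i j. (\<phi> has_real_derivative d (cmod (U $ i $ j))) (at (cmod (U $ i $ j)))"
  shows "critical_point_on unitary_group (\<lambda>V. \<Sum>i\<in>UNIV. \<Sum>j\<in>UNIV. \<phi> (cmod (V $ i $ j))) U
    \<longleftrightarrow> self_adjoint (color_weighted d U ** cadjoint U)"
    (is "critical_point_on _ ?F U \<longleftrightarrow> self_adjoint (?G ** _)")
proof -
  have deriv: "(?F has_derivative (\<lambda>H. ?G \<bullet> H)) (at U within unitary_group)"
    using has_derivative_sum_cmod[OF nz d] by (rule has_derivative_at_withinI)
  show ?thesis
  proof
    assume "critical_point_on unitary_group ?F U"
    then obtain F' where F': "(?F has_derivative F') (at U within unitary_group)"
      and zero: "\<And>v. v \<in> tangent_space unitary_group U \<Longrightarrow> F' v = 0"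
      unfolding critical_point_on_def by auto
    show "self_adjoint (?G ** cadjoint U)"
    proof (rule self_adjointI_outer_product)
      fix v :: "complex ^ 'n" assume "v \<noteq> 0"
      then have "complex_scale \<i> (outer_product v v) ** U \<in> tangent_space unitary_group U"
        by (intro tangent_space_unitary_groupI[OF U self_adjoint_outer_product outer_product_idem])
          simp
      \<comment> \<open>The given \<open>F'\<close> agrees with the gradient pairing on tangent
        vectors, even if the two differ elsewhere.\<close>
      with has_derivative_tangent_space_unique[OF deriv F'] zero
      show "(?G ** cadjoint U) \<bullet> complex_scale \<i> (outer_product v v) = 0"
        by (metis inner_matrix_mult_right)
    qed
  next
    assume sa: "self_adjoint (?G ** cadjoint U)"
    have "?G \<bullet> v = 0" if "v \<in> tangent_space unitary_group U" for v
    proof -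
      have "v = (v ** cadjoint U) ** U"
        using U by (simp add: unitary_group_def flip: matrix_mul_assoc)
      then show ?thesis
        using self_adjoint_inner_skew[OF sa tangent_space_unitary_group_skew[OF that]]
        by (metis inner_matrix_mult_right)
    qed
    with U deriv show "critical_point_on unitary_group ?F U"
      unfolding critical_point_on_def by auto
  qed
qed

lemma self_adjoint_unitary_conj:
  assumes "U \<in> unitary_group" "self_adjoint (X ** cadjoint U)"
  shows "self_adjoint (cadjoint U ** X)"
proof -
  have "cadjoint U ** X = cadjoint U ** (X ** cadjoint U) ** U"
    using assms(1) by (simp add: unitary_group_def flip: matrix_mul_assoc)
  moreover have "cadjoint \<dots> = \<dots>"
    using assms(2) by (simp add: self_adjoint_def cadjoint_matrix_mult matrix_mul_assoc)
  ultimately show ?thesis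
    by (simp add: self_adjoint_def)
qed

text \<open>Hermite-type interpolation by a polynomial: a simple zero at \<open>r\<close> and double
  zeros at the other points of \<open>S\<close>, scaled to slope 1 at \<open>r\<close>.\<close>

lemma ex_function_derivative_indicator:
  fixes S :: "real set"
  assumes "finite S"
  shows "\<exists>\<phi>. (\<forall>x. \<phi> differentiable at x) \<and>
    (\<forall>x\<in>S. (\<phi> has_real_derivative (if x = r then 1 else 0)) (at x))"
proof -
  define q where "q x = (\<Prod>s\<in>S - {r}. (x - s))" for x
  define \<phi> where "\<phi> x = (x - r) * (q x)\<^sup>2 / (q r)\<^sup>2" for x
  have "q differentiable at x" for x
    unfolding q_def differentiable_def by (intro exI) (rule derivative_intros)+
  then obtain q' where q': "\<And>x. (q has_real_derivative q' x) (at x)"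
    by (metis real_differentiableE)
  have q0: "q r \<noteq> 0" "\<And>x. x \<in> S \<Longrightarrow> x \<noteq> r \<Longrightarrow> q x = 0"
    using assms by (auto simp: q_def)
  have \<phi>': "(\<phi> has_real_derivative ((q x)\<^sup>2 + (x - r) * (2 * q x * q' x)) / (q r)\<^sup>2) (at x)" for x
    unfolding \<phi>_def by (rule derivative_eq_intros q' refl | use q0 in \<open>simp add: field_simps\<close>)+
  have "(\<phi> has_real_derivative (if x = r then 1 else 0)) (at x)" if "x \<in> S" for x
    using \<phi>'[of x] q0(1) q0(2)[OF that] by (auto split: if_splits)
  moreover have "\<phi> differentiable at x" for x
    using \<phi>' real_differentiable_def by blast
  ultimately show ?thesis by blast
qed

theorem theorem2p4:
  fixes U :: "complex ^ 'n ^ 'n"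
  assumes "U \<in> unitary_group"
    and "\<forall>i j. U $ i $ j \<noteq> 0"
  shows "(\<forall>\<phi> :: real \<Rightarrow> real. \<phi> differentiable_on {0<..} \<longrightarrow>
            critical_point_on unitary_group
              (\<lambda>V :: complex ^ 'n ^ 'n. \<Sum>i\<in>UNIV. \<Sum>j\<in>UNIV. \<phi> (cmod (V $ i $ j))) U)
         \<longleftrightarrow> semi_balanced U"
proof
  assume crit: "\<forall>\<phi> :: real \<Rightarrow> real. \<phi> differentiable_on {0<..} \<longrightarrow>
    critical_point_on unitary_group
      (\<lambda>V :: complex ^ 'n ^ 'n. \<Sum>i\<in>UNIV. \<Sum>j\<in>UNIV. \<phi> (cmod (V $ i $ j))) U"
  have "self_adjoint (color_component r U ** cadjoint U)" for r
  proof -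
    \<comment> \<open>Interpolating on the moduli of entries isolates a single color in the
      gradient.\<close>
    have "finite (range (\<lambda>(i, j). cmod (U $ i $ j)))" by simp
    from ex_function_derivative_indicator[OF this, of r] obtain \<phi> :: "real \<Rightarrow> real"
      where \<phi>: "\<And>x. \<phi> differentiable at x"
        and \<phi>': "\<And>i j. (\<phi> has_real_derivative (if cmod (U $ i $ j) = r then 1 else 0))
          (at (cmod (U $ i $ j)))"
      by auto
    have "\<phi> differentiable_on {0<..}"
      using \<phi> by (simp add: differentiable_at_imp_differentiable_on)
    then have "self_adjoint (color_weighted (\<lambda>x. if x = r then 1 else 0) U ** cadjoint U)"
      using crit critical_point_on_unitary_group_iff[OF assms(1) _ \<phi>'] assms(2) by blast
    moreover have "color_weighted (\<lambda>x. if x = r then 1 else 0) U = color_component r U"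
      by (simp add: color_weighted_def color_component_def sgn_eq vec_eq_iff)
    ultimately show ?thesis by simp
  qed
  then show "semi_balanced U"
    using assms(1) self_adjoint_unitary_conj unfolding semi_balanced_def by blast
next
  assume sb: "semi_balanced U"
  show "\<forall>\<phi> :: real \<Rightarrow> real. \<phi> differentiable_on {0<..} \<longrightarrow>
    critical_point_on unitary_group
      (\<lambda>V :: complex ^ 'n ^ 'n. \<Sum>i\<in>UNIV. \<Sum>j\<in>UNIV. \<phi> (cmod (V $ i $ j))) U"
  proof (intro allI impI)
    fix \<phi> :: "real \<Rightarrow> real" assume "\<phi> differentiable_on {0<..}"
    then have "\<phi> differentiable at x" if "x > 0" for x
      using that by (simp add: differentiable_on_eq_differentiable_at)
    \<comment> \<open>Differentiability on the positive reals suffices, since the moduli of nonzero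
      entries are positive.\<close>
    then have \<phi>': "(\<phi> has_real_derivative deriv \<phi> x) (at x)" if "x > 0" for x
      using that by (simp add: DERIV_deriv_iff_real_differentiable)
    have "color_weighted (deriv \<phi>) U ** cadjoint U
        = (\<Sum>r\<in>range (\<lambda>(i, j). cmod (U $ i $ j)).
            deriv \<phi> r *\<^sub>R (color_component r U ** cadjoint U))"
      unfolding color_weighted_eq_sum
        bounded_bilinear.sum_left[OF bounded_bilinear_complex_matrix_mult]
        bounded_bilinear.scaleR_left[OF bounded_bilinear_complex_matrix_mult] ..
    moreover have "self_adjoint \<dots>"
      using sb assms(2) by (intro self_adjoint_sum_scaleR) (auto simp: semi_balanced_def)
    ultimately show "critical_point_on unitary_group
        (\<lambda>V :: complex ^ 'n ^ 'n. \<Sum>i\<in>UNIV. \<Sum>j\<in>UNIV. \<phi> (cmod (V $ i $ j))) U"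
      using critical_point_on_unitary_group_iff[OF assms(1), of \<phi> "deriv \<phi>"] \<phi>' assms(2) by simp
  qed
qed

end
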